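(* Let $G$ and $H$ be finite, simple, connected graphs, each with at least two vertices. Then $$\min\{g(G),g(H)\}\le g(G\boxtimes H)\le g(G)\,g(H).$$ Furthermore, both bounds are sharp, i.e. each of the two inequalities holds with equality for some such pair of graphs $G,H$.
   Context: For a connected graph $G$, $d_G(u,v)$ is the distance between $u$ and $v$. The closed interval $I[x,y]$ consists of $x$, $y$ and all vertices lying on some shortest $x$–$y$ path. For $S\subseteq V(G)$, $I[S]=\bigcup_{u,v\in S}I[u,v]$. A set $S$ is geodetic if $I[S]=V(G)$; the geodetic number $g(G)$ is the minimum cardinality of a geodetic set of $G$. The strong product $G\boxtimes H$ has vertex set $V(G)\times V(H)$, with $(g,h)$ and $(g',h')$ adjacent whenever ($g=g'$ and $hh'\in E(H)$), or ($h=h'$ and $gg'\in E(G)$), or ($gg'\in E(G)$ and $hh'\in E(H)$). *)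

theory Defs
  imports "Graph_Theory.Graph_Theory"
begin

text \<open>
  Finite simple graphs are represented by \<^locale>\<open>pair_graph\<close>: finite, loop-free, without parallel
  arcs, and symmetric, so that an undirected edge \<open>uv\<close> is the pair of arcs \<open>(u,v)\<close>, \<open>(v,u)\<close>.
\<close>

definition nontrivial_connected_graph :: "'a pair_pre_digraph \<Rightarrow> bool" where
  "nontrivial_connected_graph G \<longleftrightarrow>
     pair_graph G \<and> Digraph_Component.connected (with_proj G) \<and> 2 \<le> card (pverts G)"

text \<open>The distance is the library's weighted distance, with all arcs of weight one.\<close>

definition gdist :: "'a pair_pre_digraph \<Rightarrow> 'a \<Rightarrow> 'a \<Rightarrow> ereal" where
  "gdist G u v = wf_digraph.\<mu> (with_proj G) (\<lambda>_. 1) u v"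

definition shortest_path :: "'a pair_pre_digraph \<Rightarrow> 'a \<Rightarrow> ('a \<times> 'a) awalk \<Rightarrow> 'a \<Rightarrow> bool" where
  "shortest_path G u p v \<longleftrightarrow>
     pre_digraph.apath (with_proj G) u p v \<and> ereal (real (length p)) = gdist G u v"

definition interval :: "'a pair_pre_digraph \<Rightarrow> 'a \<Rightarrow> 'a \<Rightarrow> 'a set" where
  "interval G x y =
     {x, y} \<union> {w. \<exists>p. shortest_path G x p y \<and> w \<in> set (pre_digraph.awalk_verts (with_proj G) x p)}"

definition interval_set :: "'a pair_pre_digraph \<Rightarrow> 'a set \<Rightarrow> 'a set" where
  "interval_set G S = (\<Union>u\<in>S. \<Union>v\<in>S. interval G u v)"

definition geodetic_set :: "'a pair_pre_digraph \<Rightarrow> 'a set \<Rightarrow> bool" where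
  "geodetic_set G S \<longleftrightarrow> S \<subseteq> pverts G \<and> interval_set G S = pverts G"

definition geodetic_number :: "'a pair_pre_digraph \<Rightarrow> nat" where
  "geodetic_number G = Min (card ` {S. geodetic_set G S})"

definition strong_product ::
    "'a pair_pre_digraph \<Rightarrow> 'b pair_pre_digraph \<Rightarrow> ('a \<times> 'b) pair_pre_digraph"  (infixl \<open>\<boxtimes>\<close> 70) where
  "G \<boxtimes> H =
     \<lparr> pverts = pverts G \<times> pverts H,
       parcs = {((g, h), (g', h')) | g h g' h'.
         g \<in> pverts G \<and> g = g' \<and> (h, h') \<in> parcs H \<or>
         h \<in> pverts H \<and> h = h' \<and> (g, g') \<in> parcs G \<or>
         (g, g') \<in> parcs G \<and> (h, h') \<in> parcs H} \<rparr>"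

end

theory Submission
  imports Defs
begin

text \<open>
  Distances in \<open>G \<boxtimes> H\<close> are maxima of distances in the factors. If \<open>S\<close> is geodetic in \<open>G \<boxtimes> H\<close>, then
  one of its projections is geodetic: were \<open>g\<close> and \<open>h\<close> missed by the two projections, a pair of \<open>S\<close>
  having \<open>(g, h)\<close> in its interval would realise its distance in one coordinate, and the projected
  pair would cover \<open>g\<close> or \<open>h\<close>. Conversely, if \<open>g\<close> lies between \<open>s, s'\<close> and \<open>h\<close> between \<open>t, t'\<close>, take
  the least of the four distances from \<open>g\<close> or \<open>h\<close> to these ends; if it is \<open>d(t, h)\<close>, then \<open>(g, h)\<close>
  lies between \<open>(s, t)\<close> and \<open>(s', t)\<close>, so products of geodetic sets are geodetic.

  The upper bound is attained by \<open>K\<^sub>2 \<boxtimes> K\<^sub>2 = K\<^sub>4\<close>. The lower bound is attained by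
  \<open>K\<^sub>4\<^sub>,\<^sub>4 \<boxtimes> K\<^sub>4\<close>: two vertices from each side of \<open>K\<^sub>4\<^sub>,\<^sub>4\<close> form a geodetic set each of whose vertices is
  strictly between two others, so a single copy of it already covers the product.
\<close>

section \<open>Distances as lengths of lazy walks\<close>

text \<open>
  Allowing a walk to stay put makes the step relation of \<open>G \<boxtimes> H\<close> the product of those of the factors.
\<close>

definition lazy_step :: "'a pair_pre_digraph \<Rightarrow> 'a rel" where
  "lazy_step G = {(u, v). u \<in> pverts G \<and> v \<in> pverts G \<and> (u = v \<or> (u, v) \<in> parcs G)}"

text \<open>The graph distance as a natural number. The \<open>LEAST\<close> is meaningful only
  where some lazy walk exists, which \<open>connected_pair_graph\<close> guarantees between
  vertices.\<close>

definition hops :: "'a pair_pre_digraph \<Rightarrow> 'a \<Rightarrow> 'a \<Rightarrow> nat" where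
  "hops G u v = (LEAST n. (u, v) \<in> lazy_step G ^^ n)"

lemma lazy_step_pow_in_verts:
  "(u, v) \<in> lazy_step G ^^ n \<Longrightarrow> u \<in> pverts G \<Longrightarrow> v \<in> pverts G"
  by (cases n) (auto simp: lazy_step_def)

text \<open>Surplus steps are spent waiting at \<open>v\<close>. As the zeroth power is the identity
  on the whole type, \<open>v\<close> is known to be a vertex only because \<open>u\<close>
  is.\<close>

lemma lazy_step_pow_mono:
  assumes "(u, v) \<in> lazy_step G ^^ m" "m \<le> n" "u \<in> pverts G"
  shows "(u, v) \<in> lazy_step G ^^ n"
  using assms(2)
proof (induction n rule: dec_induct)
  case base
  show ?case by (rule assms(1))
next
  case (step n)
  have "(v, v) \<in> lazy_step G"
    using lazy_step_pow_in_verts[OF assms(1,3)] by (simp add: lazy_step_def)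
  with step.IH show ?case by (rule relpow_Suc_I)
qed

section \<open>Translation between walks and lazy walks\<close>

context pair_wf_digraph
begin

lemma awalk_imp_lazy_step_pow: "awalk u p v \<Longrightarrow> (u, v) \<in> lazy_step G ^^ length p"
proof (induction p arbitrary: u)
  case (Cons e p)
  then have "(u, snd e) \<in> lazy_step G" "(snd e, v) \<in> lazy_step G ^^ length p"
    by (auto simp: awalk_Cons_iff lazy_step_def intro: wellformed')
  then show ?case using relpow_Suc_I2 by fastforce
qed (simp add: awalk_Nil_iff)

text \<open>Waiting steps are dropped, so the walk obtained may be shorter than
  \<open>n\<close>.\<close>

lemma lazy_step_pow_imp_awalk:
  assumes "(u, v) \<in> lazy_step G ^^ n" "u \<in> pverts G"
  shows "\<exists>p. awalk u p v \<and> length p \<le> n"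
  using assms(1)
proof (induction n arbitrary: v)
  case 0
  then show ?case using assms(2) by (auto intro!: exI[of _ "[]"] simp: awalk_Nil_iff)
next
  case (Suc n)
  then obtain w where w: "(u, w) \<in> lazy_step G ^^ n" "(w, v) \<in> lazy_step G" by auto
  with Suc.IH obtain p where p: "awalk u p w" "length p \<le> n" by blast
  show ?case
  proof (cases "w = v")
    case True
    with p show ?thesis by auto
  next
    case False
    with w(2) have "(w, v) \<in> parcs G" by (auto simp: lazy_step_def)
    then have "awalk w [(w, v)] v" by (simp add: awalk_simps wellformed')
    with p(1) have "awalk u (p @ [(w, v)]) v" by (rule awalk_appendI)
    with p(2) show ?thesis by (intro exI[of _ "p @ [(w, v)]"]) simp
  qed
qed

end

text \<open>Connectivity is phrased with lazy walks so that it passes to products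
  coordinatewise.\<close>

locale connected_pair_graph = pair_graph +
  assumes lazy_connected:
    "u \<in> pverts G \<Longrightarrow> v \<in> pverts G \<Longrightarrow> \<exists>n. (u, v) \<in> lazy_step G ^^ n"
begin

text \<open>The set of lengths of lazy walks from \<open>u\<close> to \<open>v\<close> is upward
  closed, hence determined by its least element. Two distances can thus be compared through their
  upper bounds \<open>n\<close>.\<close>

lemma lazy_step_pow_iff_hops_le:
  assumes "u \<in> pverts G" "v \<in> pverts G"
  shows "(u, v) \<in> lazy_step G ^^ n \<longleftrightarrow> hops G u v \<le> n"
proof
  assume "(u, v) \<in> lazy_step G ^^ n"
  then show "hops G u v \<le> n" unfolding hops_def by (rule Least_le)
next
  have "(u, v) \<in> lazy_step G ^^ hops G u v"
    unfolding hops_def using lazy_connected[OF assms] by (rule LeastI_ex)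
  moreover assume "hops G u v \<le> n"
  ultimately show "(u, v) \<in> lazy_step G ^^ n" using assms(1) lazy_step_pow_mono by metis
qed

lemma hops_le_length: "awalk u p v \<Longrightarrow> hops G u v \<le> length p"
  using awalk_imp_lazy_step_pow lazy_step_pow_iff_hops_le
  by (metis awalk_hd_in_verts awalk_last_in_verts)

lemma shortest_awalk_exists:
  assumes "u \<in> pverts G" "v \<in> pverts G"
  shows "\<exists>p. awalk u p v \<and> length p = hops G u v"
proof -
  obtain p where "awalk u p v" "length p \<le> hops G u v"
    using lazy_step_pow_imp_awalk lazy_step_pow_iff_hops_le assms by (metis order_refl)
  with hops_le_length show ?thesis by (meson le_antisym)
qed

lemma hops_triangle:
  assumes "u \<in> pverts G" "v \<in> pverts G" "w \<in> pverts G"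
  shows "hops G u w \<le> hops G u v + hops G v w"
proof -
  obtain p q where pq: "awalk u p v" "length p = hops G u v" "awalk v q w" "length q = hops G v w"
    using shortest_awalk_exists assms by meson
  from pq(1,3) have "awalk u (p @ q) w" by (rule awalk_appendI)
  from hops_le_length[OF this] pq(2,4) show ?thesis by simp
qed

lemma hops_commute:
  assumes "u \<in> pverts G" "v \<in> pverts G"
  shows "hops G u v = hops G v u"
proof -
  have "hops G y x \<le> hops G x y" if xy: "x \<in> pverts G" "y \<in> pverts G" for x y
  proof -
    obtain p where p: "awalk x p y" "length p = hops G x y"
      using shortest_awalk_exists[OF xy] by metis
    have "length (rev_path p) = length p" by (induction p) auto
    with hops_le_length[OF awalk_rev_path'[OF p(1)]] p(2) show ?thesis by simp
  qed
  with assms show ?thesis by (meson le_antisym)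
qed

lemma hops_eq_0_iff: "u \<in> pverts G \<Longrightarrow> v \<in> pverts G \<Longrightarrow> hops G u v = 0 \<longleftrightarrow> u = v"
  using lazy_step_pow_iff_hops_le[of u v 0] by auto

lemma hops_le_1_iff:
  "u \<in> pverts G \<Longrightarrow> v \<in> pverts G \<Longrightarrow> hops G u v \<le> 1 \<longleftrightarrow> u = v \<or> (u, v) \<in> parcs G"
  using lazy_step_pow_iff_hops_le[of u v 1] by (auto simp: lazy_step_def)

section \<open>Agreement of \<open>hops\<close> with the library distance and with intervals\<close>

lemma gdist_eq_hops:
  assumes "u \<in> pverts G" "v \<in> pverts G"
  shows "gdist G u v = ereal (real (hops G u v))"
proof -
  have cost: "awalk_cost (\<lambda>_. 1) p = real (length p)" for p :: "('a \<times> 'a) list"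
    by (induction p) auto
  obtain p where "awalk u p v" "length p = hops G u v"
    using shortest_awalk_exists[OF assms] by metis
  then show ?thesis
    unfolding gdist_def \<mu>_def cost
    by (intro antisym INF_greatest INF_lower2[of p]) (simp_all add: hops_le_length)
qed

text \<open>A repeated vertex would close a nonempty cycle, and cutting it out would give a walk
  shorter than the distance.\<close>

lemma apath_if_length_eq_hops:
  assumes "awalk u p v" "length p = hops G u v"
  shows "apath u p v"
proof (rule ccontr)
  assume "\<not> apath u p v"
  with assms(1) have "\<not> distinct (awalk_verts u p)" by (simp add: apath_def)
  with assms(1) obtain q r s w where
    d: "p = q @ r @ s" "distinct (awalk_verts u q)" "0 < length r"
       "awalk u q w" "awalk w r w" "awalk w s v"
    using awalk_not_distinct_decomp by metis
  from d(4,6) have "awalk u (q @ s) v" by (rule awalk_appendI)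
  from hops_le_length[OF this] d(3) assms(2)[unfolded d(1)]
  show False by (simp del: length_greater_0_conv)
qed

text \<open>Reduces intervals to metric betweenness, so that later arguments about geodetic sets
  need no paths. Splitting a shortest path at \<open>w\<close> gives one direction, with the
  triangle inequality; joining two shortest walks at \<open>w\<close> gives the other.\<close>

lemma mem_interval_iff:
  assumes uv: "u \<in> pverts G" "v \<in> pverts G"
  shows "w \<in> interval G u v \<longleftrightarrow> w \<in> pverts G \<and> hops G u w + hops G w v = hops G u v"
proof
  assume w: "w \<in> interval G u v"
  show "w \<in> pverts G \<and> hops G u w + hops G w v = hops G u v"
  proof (cases "w = u \<or> w = v")
    case True
    with uv show ?thesis using hops_eq_0_iff by auto
  next
    case False
    with w obtain p where p: "apath u p v" "length p = hops G u v" "w \<in> set (awalk_verts u p)"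
      unfolding interval_def shortest_path_def gdist_eq_hops[OF uv]
      by (auto simp: awalk_verts_with_proj_eq)
    then obtain q r where "p = q @ r" "awalk u q w" "awalk w r v"
      using awalk_decomp awalkI_apath by metis
    then have "w \<in> pverts G" "hops G u w + hops G w v \<le> hops G u v"
      using p(2) awalk_hd_in_verts hops_le_length[of u q w] hops_le_length[of w r v] by simp_all
    with hops_triangle[of u w v] uv show ?thesis by simp
  qed
next
  assume w: "w \<in> pverts G \<and> hops G u w + hops G w v = hops G u v"
  obtain q r where qr: "awalk u q w" "length q = hops G u w" "awalk w r v" "length r = hops G w v"
    using shortest_awalk_exists w uv by meson
  from qr(1,3) have walk: "awalk u (q @ r) v" by (rule awalk_appendI)
  then have "apath u (q @ r) v"
    by (rule apath_if_length_eq_hops) (simp add: qr w)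
  moreover have "w \<in> set (awalk_verts u (q @ r))"
    using hd_in_awalk_verts(1)[OF qr(3)] set_awalk_verts_append[OF qr(1,3)] by simp
  ultimately show "w \<in> interval G u v"
    unfolding interval_def shortest_path_def gdist_eq_hops[OF uv]
    using qr(2,4) w by (force simp: awalk_verts_with_proj_eq)
qed

section \<open>Geodetic sets and the geodetic number\<close>

lemma interval_set_subset: "S \<subseteq> pverts G \<Longrightarrow> interval_set G S \<subseteq> pverts G"
  by (auto simp: interval_set_def mem_interval_iff subset_iff)

lemma geodetic_setI:
  assumes "S \<subseteq> pverts G"
    and "\<And>w. w \<in> pverts G \<Longrightarrow> \<exists>u\<in>S. \<exists>v\<in>S. hops G u w + hops G w v = hops G u v"
  shows "geodetic_set G S"
proof -
  have "w \<in> interval_set G S" if "w \<in> pverts G" for w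
    using assms that mem_interval_iff unfolding interval_set_def subset_iff by (metis UN_I)
  with assms(1) interval_set_subset show ?thesis unfolding geodetic_set_def by blast
qed

lemma geodetic_setD:
  assumes "geodetic_set G S" "w \<in> pverts G"
  obtains u v where "u \<in> S" "v \<in> S" "hops G u w + hops G w v = hops G u v"
proof -
  from assms have "S \<subseteq> pverts G" "w \<in> interval_set G S" by (auto simp: geodetic_set_def)
  then obtain u v where "u \<in> S" "v \<in> S" "w \<in> interval G u v" by (auto simp: interval_set_def)
  with \<open>S \<subseteq> pverts G\<close> that show ?thesis using mem_interval_iff by blast
qed

text \<open>Makes the family of geodetic sets nonempty, so that the \<open>Min\<close> in
  \<open>geodetic_number\<close> is attained.\<close>

lemma geodetic_set_verts: "geodetic_set G (pverts G)"
proof (rule geodetic_setI)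
  fix w assume "w \<in> pverts G"
  then show "\<exists>u\<in>pverts G. \<exists>v\<in>pverts G. hops G u w + hops G w v = hops G u v"
    using hops_eq_0_iff[of w w] by (intro bexI[of _ w]) auto
qed simp

lemma finite_geodetic_sets: "finite {S. geodetic_set G S}"
  by (rule finite_subset[of _ "Pow (pverts G)"])
     (auto simp: geodetic_set_def pair_finite_verts)

lemma geodetic_number_le: "geodetic_set G S \<Longrightarrow> geodetic_number G \<le> card S"
  unfolding geodetic_number_def by (intro Min_le) (auto simp: finite_geodetic_sets)

lemma geodetic_number_attained:
  obtains S where "geodetic_set G S" "card S = geodetic_number G"
proof -
  have "geodetic_number G \<in> card ` {S. geodetic_set G S}"
    unfolding geodetic_number_def using finite_geodetic_sets geodetic_set_verts
    by (intro Min_in) auto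
  with that show ?thesis by auto
qed

lemma geodetic_number_complete:
  assumes "\<And>u v. u \<in> pverts G \<Longrightarrow> v \<in> pverts G \<Longrightarrow> u \<noteq> v \<Longrightarrow> (u, v) \<in> parcs G"
  shows "geodetic_number G = card (pverts G)"
proof -
  obtain S where S: "geodetic_set G S" "card S = geodetic_number G"
    using geodetic_number_attained .
  then have sub: "S \<subseteq> pverts G" by (simp add: geodetic_set_def)
  have "w \<in> S" if w: "w \<in> pverts G" for w
  proof -
    obtain u v where uv: "u \<in> S" "v \<in> S" "hops G u w + hops G w v = hops G u v"
      using geodetic_setD[OF S(1) w] .
    moreover have "hops G u v \<le> 1" using assms uv sub hops_le_1_iff by blast
    \<comment> \<open>Two natural numbers with sum at most 1 cannot both be positive, so
      \<open>w\<close> is one of the ends \<open>u\<close>, \<open>v\<close>.\<close>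
    ultimately have "hops G u w = 0 \<or> hops G w v = 0" by linarith
    with uv sub w show ?thesis using hops_eq_0_iff by blast
  qed
  with sub have "S = pverts G" by blast
  with S(2) show ?thesis by simp
qed

end

text \<open>The library defines connectedness as strong connectedness of the symmetric closure. Here
  the arcs are already symmetric, so it amounts to reachability between all vertices of a nonempty
  vertex set.\<close>

lemma nontrivial_connected_graph_iff:
  "nontrivial_connected_graph G \<longleftrightarrow> connected_pair_graph G \<and> 2 \<le> card (pverts G)"
proof (cases "pair_graph G \<and> 2 \<le> card (pverts G)")
  case True
  then interpret pair_graph G by simp
  have "(\<exists>n. (u, v) \<in> lazy_step G ^^ n) \<longleftrightarrow> u \<rightarrow>\<^sup>*\<^bsub>with_proj G\<^esub> v" if "u \<in> pverts G" for u v
    unfolding reachable_awalk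
    using awalk_imp_lazy_step_pow lazy_step_pow_imp_awalk[OF _ that] by meson
  moreover have "pverts G \<noteq> {}" using True by auto
  moreover have "Digraph_Component.connected (with_proj G) \<longleftrightarrow> strongly_connected (with_proj G)"
    unfolding Digraph_Component.connected_def strongly_connected_def
    using reachable_mk_symmetric_eq[OF sym_arcs] by simp
  ultimately show ?thesis
    using True
    by (auto simp: nontrivial_connected_graph_def connected_pair_graph_def
        connected_pair_graph_axioms_def strongly_connected_def)
next
  case False
  then show ?thesis
    by (auto simp: nontrivial_connected_graph_def connected_pair_graph_def)
qed

section \<open>Strong products\<close>

lemma verts_strong_product [simp]: "pverts (G \<boxtimes> H) = pverts G \<times> pverts H"
  by (simp add: strong_product_def)

lemma lazy_step_strong_product:
  "((x, y), (x', y')) \<in> lazy_step (G \<boxtimes> H) \<longleftrightarrow> (x, x') \<in> lazy_step G \<and> (y, y') \<in> lazy_step H"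
  by (auto simp: lazy_step_def strong_product_def)

text \<open>Without waiting, the projections of a walk of length \<open>n\<close> could be shorter
  than \<open>n\<close>; with it, both have length exactly \<open>n\<close>.\<close>

lemma lazy_step_pow_strong_product:
  "((x, y), (x', y')) \<in> lazy_step (G \<boxtimes> H) ^^ n \<longleftrightarrow>
     (x, x') \<in> lazy_step G ^^ n \<and> (y, y') \<in> lazy_step H ^^ n"
proof (induction n arbitrary: x' y')
  case (Suc n)
  show ?case by (auto simp: relcomp_unfold Suc.IH lazy_step_strong_product)
qed auto

locale connected_pair_graph_pair =
  G: connected_pair_graph G + H: connected_pair_graph H
  for G :: "'a pair_pre_digraph" and H :: "'b pair_pre_digraph"
begin

sublocale P: connected_pair_graph "G \<boxtimes> H"
proof
  show "finite (parcs (G \<boxtimes> H))"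
  proof (rule finite_subset)
    show "parcs (G \<boxtimes> H) \<subseteq> (pverts G \<times> pverts H) \<times> (pverts G \<times> pverts H)"
      by (auto simp: strong_product_def dest: G.wellformed' H.wellformed')
    show "finite ((pverts G \<times> pverts H) \<times> (pverts G \<times> pverts H))"
      by (simp add: G.pair_finite_verts H.pair_finite_verts)
  qed
next
  fix u v assume "u \<in> pverts (G \<boxtimes> H)" "v \<in> pverts (G \<boxtimes> H)"
  then obtain x y x' y' where
    "u = (x, y)" "v = (x', y')" "x \<in> pverts G" "x' \<in> pverts G" "y \<in> pverts H" "y' \<in> pverts H"
    by auto
  \<comment> \<open>Both coordinates move at once, and the one that arrives first waits for the
    other.\<close>
  then have "(u, v) \<in> lazy_step (G \<boxtimes> H) ^^ max (hops G x x') (hops H y y')"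
    by (simp add: lazy_step_pow_strong_product
        G.lazy_step_pow_iff_hops_le H.lazy_step_pow_iff_hops_le)
  then show "\<exists>n. (u, v) \<in> lazy_step (G \<boxtimes> H) ^^ n" ..
next
  show "symmetric (with_proj (G \<boxtimes> H))"
    by (auto simp: symmetric_def sym_def strong_product_def
        dest: G.arcs_symmetric H.arcs_symmetric)
qed (auto simp: strong_product_def G.pair_finite_verts H.pair_finite_verts
    dest: G.wellformed' H.wellformed' G.no_loops' H.no_loops')

text \<open>Both sides have the same upper bounds \<open>n\<close>, because lazy walks of length
  \<open>n\<close> split into coordinates.\<close>

lemma hops_strong_product:
  assumes "x \<in> pverts G" "x' \<in> pverts G" "y \<in> pverts H" "y' \<in> pverts H"
  shows "hops (G \<boxtimes> H) (x, y) (x', y') = max (hops G x x') (hops H y y')"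
proof -
  have "hops (G \<boxtimes> H) (x, y) (x', y') \<le> n \<longleftrightarrow> max (hops G x x') (hops H y y') \<le> n" for n
    using P.lazy_step_pow_iff_hops_le[of "(x, y)" "(x', y')" n] assms
    by (simp add: lazy_step_pow_strong_product
        G.lazy_step_pow_iff_hops_le H.lazy_step_pow_iff_hops_le)
  then show ?thesis by (meson le_antisym order_refl)
qed

lemma geodetic_set_Times:
  assumes S: "geodetic_set G S" and T: "geodetic_set H T"
  shows "geodetic_set (G \<boxtimes> H) (S \<times> T)"
proof (rule P.geodetic_setI)
  have sub: "S \<subseteq> pverts G" "T \<subseteq> pverts H" using S T by (auto simp: geodetic_set_def)
  then show "S \<times> T \<subseteq> pverts (G \<boxtimes> H)" by auto
  fix w assume "w \<in> pverts (G \<boxtimes> H)"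
  let ?covered = "\<exists>u\<in>S \<times> T. \<exists>v\<in>S \<times> T.
      hops (G \<boxtimes> H) u w + hops (G \<boxtimes> H) w v = hops (G \<boxtimes> H) u v"
  from \<open>w \<in> pverts (G \<boxtimes> H)\<close> obtain g h
    where w: "w = (g, h)" and gh: "g \<in> pverts G" "h \<in> pverts H" by auto
  obtain s s' where s: "s \<in> S" "s' \<in> S" "hops G s g + hops G g s' = hops G s s'"
    using G.geodetic_setD[OF S gh(1)] .
  obtain t t' where t: "t \<in> T" "t' \<in> T" "hops H t h + hops H h t' = hops H t t'"
    using H.geodetic_setD[OF T gh(2)] .
  have V: "s \<in> pverts G" "s' \<in> pverts G" "t \<in> pverts H" "t' \<in> pverts H" using s t sub by auto
  \<comment> \<open>With \<open>t0\<close> in both end points, the \<open>G\<close> coordinate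
    attains each of the three maxima, so betweenness of \<open>g\<close> in \<open>G\<close> carries
    over to \<open>w\<close>.\<close>
  have covered_by_G: ?covered
    if "t0 \<in> T" "hops H t0 h \<le> hops G s g" "hops H t0 h \<le> hops G g s'" for t0
  proof (intro bexI)
    have "t0 \<in> pverts H" using that sub by auto
    then show "hops (G \<boxtimes> H) (s, t0) w + hops (G \<boxtimes> H) w (s', t0) = hops (G \<boxtimes> H) (s, t0) (s', t0)"
      using that V gh s H.hops_commute[of h t0] H.hops_eq_0_iff[of t0 t0]
      by (simp add: w hops_strong_product)
  qed (use s that in auto)
  have covered_by_H: ?covered
    if "s0 \<in> S" "hops G s0 g \<le> hops H t h" "hops G s0 g \<le> hops H h t'" for s0
  proof (intro bexI)
    have "s0 \<in> pverts G" using that sub by auto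
    then show "hops (G \<boxtimes> H) (s0, t) w + hops (G \<boxtimes> H) w (s0, t') = hops (G \<boxtimes> H) (s0, t) (s0, t')"
      using that V gh t G.hops_commute[of g s0] G.hops_eq_0_iff[of s0 s0]
      by (simp add: w hops_strong_product)
  qed (use t that in auto)
  have "hops G g s' = hops G s' g" "hops H h t' = hops H t' h"
    using V gh G.hops_commute H.hops_commute by auto
  \<comment> \<open>Whichever of the four distances is least satisfies both bounds in one of the
    four instances.\<close>
  then show ?covered
    using covered_by_G[of t] covered_by_G[of t'] covered_by_H[of s] covered_by_H[of s'] s t
    by linarith
qed

lemma geodetic_set_projection:
  assumes S: "geodetic_set (G \<boxtimes> H) S"
  shows "geodetic_set G (fst ` S) \<or> geodetic_set H (snd ` S)"
proof (rule ccontr)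
  assume neg: "\<not> ?thesis"
  have sub: "S \<subseteq> pverts G \<times> pverts H" using S by (simp add: geodetic_set_def)
  have "\<exists>g\<in>pverts G. \<forall>p\<in>S. \<forall>q\<in>S.
      hops G (fst p) g + hops G g (fst q) \<noteq> hops G (fst p) (fst q)"
    using neg G.geodetic_setI[of "fst ` S"] sub by fastforce
  then obtain g where g: "g \<in> pverts G" "\<And>p q. p \<in> S \<Longrightarrow> q \<in> S \<Longrightarrow>
      hops G (fst p) g + hops G g (fst q) \<noteq> hops G (fst p) (fst q)" by blast
  have "\<exists>h\<in>pverts H. \<forall>p\<in>S. \<forall>q\<in>S.
      hops H (snd p) h + hops H h (snd q) \<noteq> hops H (snd p) (snd q)"
    using neg H.geodetic_setI[of "snd ` S"] sub by fastforce
  then obtain h where h: "h \<in> pverts H" "\<And>p q. p \<in> S \<Longrightarrow> q \<in> S \<Longrightarrow>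
      hops H (snd p) h + hops H h (snd q) \<noteq> hops H (snd p) (snd q)" by blast
  have "(g, h) \<in> pverts (G \<boxtimes> H)" using g(1) h(1) by simp
  then obtain p q where pq: "p \<in> S" "q \<in> S"
      "hops (G \<boxtimes> H) p (g, h) + hops (G \<boxtimes> H) (g, h) q = hops (G \<boxtimes> H) p q"
    using P.geodetic_setD[OF S] by metis
  obtain x y x' y' where xy: "p = (x, y)" "q = (x', y')" by fastforce
  with pq sub have V: "x \<in> pverts G" "x' \<in> pverts G" "y \<in> pverts H" "y' \<in> pverts H" by auto
  have "max (hops G x g) (hops H y h) + max (hops G g x') (hops H h y') =
      max (hops G x x') (hops H y y')"
    using pq(3) V g(1) h(1) by (simp add: xy hops_strong_product)
  \<comment> \<open>The choice of \<open>g\<close> and \<open>h\<close> makes both triangle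
    inequalities strict, so the sum of maxima exceeds each distance on the right, hence also their
    maximum.\<close>
  moreover have "hops G x x' < hops G x g + hops G g x'"
    using G.hops_triangle[OF V(1) g(1) V(2)] g(2)[OF pq(1,2)] xy by simp
  moreover have "hops H y y' < hops H y h + hops H h y'"
    using H.hops_triangle[OF V(3) h(1) V(4)] h(2)[OF pq(1,2)] xy by simp
  ultimately show False by linarith
qed

lemma geodetic_number_strong_product_le:
  "geodetic_number (G \<boxtimes> H) \<le> geodetic_number G * geodetic_number H"
proof -
  obtain S where S: "geodetic_set G S" "card S = geodetic_number G"
    using G.geodetic_number_attained .
  obtain T where T: "geodetic_set H T" "card T = geodetic_number H"
    using H.geodetic_number_attained .
  show ?thesis
    using P.geodetic_number_le[OF geodetic_set_Times[OF S(1) T(1)]] S T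
    by (simp add: card_cartesian_product)
qed

lemma min_geodetic_number_le_strong_product:
  "min (geodetic_number G) (geodetic_number H) \<le> geodetic_number (G \<boxtimes> H)"
proof -
  obtain S where S: "geodetic_set (G \<boxtimes> H) S" "card S = geodetic_number (G \<boxtimes> H)"
    using P.geodetic_number_attained .
  have "finite S"
    using S(1) P.pair_finite_verts by (auto simp: geodetic_set_def intro: finite_subset)
  then have "card (fst ` S) \<le> card S" "card (snd ` S) \<le> card S" by (auto intro: card_image_le)
  then show ?thesis
    using geodetic_set_projection[OF S(1)] G.geodetic_number_le[of "fst ` S"]
      H.geodetic_number_le[of "snd ` S"] S(2) by linarith
qed

end

section \<open>Sharpness\<close>

definition complete_graph :: "nat \<Rightarrow> nat pair_pre_digraph" where
  "complete_graph n = \<lparr>pverts = {..<n}, parcs = {(u, v). u < n \<and> v < n \<and> u \<noteq> v}\<rparr>"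

lemma connected_complete_graph: "connected_pair_graph (complete_graph n)"
proof
  show "finite (parcs (complete_graph n))"
    by (rule finite_subset[of _ "{..<n} \<times> {..<n}"]) (auto simp: complete_graph_def)
  show "symmetric (with_proj (complete_graph n))"
    by (auto simp: symmetric_def sym_def complete_graph_def)
  show "\<exists>m. (u, v) \<in> lazy_step (complete_graph n) ^^ m"
    if "u \<in> pverts (complete_graph n)" "v \<in> pverts (complete_graph n)" for u v
    using that by (intro exI[of _ 1]) (auto simp: complete_graph_def lazy_step_def)
qed (auto simp: complete_graph_def)

lemma geodetic_number_complete_graph: "geodetic_number (complete_graph n) = n"
  using connected_pair_graph.geodetic_number_complete[OF connected_complete_graph, of n]
  by (simp add: complete_graph_def)

text \<open>The parity classes of \<open>{..<2 * n}\<close> are the two sides of \<open>K\<^sub>n\<^sub>,\<^sub>n\<close>.\<close>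

definition bipartite_graph :: "nat \<Rightarrow> nat pair_pre_digraph" where
  "bipartite_graph n =
     \<lparr>pverts = {..<2 * n}, parcs = {(u, v). u < 2 * n \<and> v < 2 * n \<and> even u \<noteq> even v}\<rparr>"

lemma lazy_step_bipartite_graph:
  "(u, v) \<in> lazy_step (bipartite_graph n) \<longleftrightarrow>
     u < 2 * n \<and> v < 2 * n \<and> (u = v \<or> even u \<noteq> even v)"
  by (auto simp: bipartite_graph_def lazy_step_def)

lemma lazy_step_2_bipartite_graph:
  assumes "u < 2 * n" "v < 2 * n"
  shows "(u, v) \<in> lazy_step (bipartite_graph n) ^^ 2"
proof -
  have "\<exists>w. (u, w) \<in> lazy_step (bipartite_graph n) \<and> (w, v) \<in> lazy_step (bipartite_graph n)"
    using assms
    \<comment> \<open>If \<open>u\<close> and \<open>v\<close> are on opposite sides, step to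
      \<open>v\<close> and wait. Otherwise pass through vertex 1 or 0 on the other side, which
      exists since \<open>u < 2 * n\<close> forces \<open>n\<close> to be positive.\<close>
    by (intro exI[of _ "if even u \<noteq> even v then v else if even u then 1 else 0"])
       (auto simp: lazy_step_bipartite_graph elim!: oddE evenE)
  then show ?thesis by (auto simp: numeral_2_eq_2)
qed

lemma connected_bipartite_graph: "connected_pair_graph (bipartite_graph n)"
proof
  show "finite (parcs (bipartite_graph n))"
    by (rule finite_subset[of _ "{..<2 * n} \<times> {..<2 * n}"]) (auto simp: bipartite_graph_def)
  show "symmetric (with_proj (bipartite_graph n))"
    by (auto simp: symmetric_def sym_def bipartite_graph_def)
  show "\<exists>m. (u, v) \<in> lazy_step (bipartite_graph n) ^^ m"
    if "u \<in> pverts (bipartite_graph n)" "v \<in> pverts (bipartite_graph n)" for u v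
    using that lazy_step_2_bipartite_graph by (auto simp: bipartite_graph_def)
qed (auto simp: bipartite_graph_def)

lemma hops_bipartite_graph:
  assumes "u < 2 * n" "v < 2 * n"
  shows "hops (bipartite_graph n) u v = (if u = v then 0 else if even u = even v then 2 else 1)"
proof -
  interpret connected_pair_graph "bipartite_graph n" by (rule connected_bipartite_graph)
  have V: "u \<in> pverts (bipartite_graph n)" "v \<in> pverts (bipartite_graph n)"
    using assms by (auto simp: bipartite_graph_def)
  have "hops (bipartite_graph n) u v \<le> 2"
    using lazy_step_pow_iff_hops_le[OF V] lazy_step_2_bipartite_graph[OF assms] by blast
  moreover have "hops (bipartite_graph n) u v \<le> 1 \<longleftrightarrow> u = v \<or> even u \<noteq> even v"
    using hops_le_1_iff[OF V] assms by (auto simp: bipartite_graph_def)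
  ultimately show ?thesis using hops_eq_0_iff[OF V] by (auto split: if_splits)
qed

text \<open>A vertex outside \<open>S\<close> must be the midpoint of two members of
  \<open>S\<close> on the opposite side. So either \<open>S\<close> contains a whole side, which has
  four vertices, or it has at least two vertices on each side.\<close>

lemma geodetic_number_bipartite_graph_ge: "4 \<le> geodetic_number (bipartite_graph 4)"
proof -
  let ?B = "bipartite_graph 4"
  interpret connected_pair_graph ?B by (rule connected_bipartite_graph)
  obtain S where S: "geodetic_set ?B S" "card S = geodetic_number ?B"
    using geodetic_number_attained .
  have sub: "S \<subseteq> {..<8}" using S(1) by (simp add: geodetic_set_def bipartite_graph_def)
  then have fin: "finite S" by (rule finite_subset) simp
  have opposite: "\<exists>u\<in>S. \<exists>v\<in>S. u \<noteq> v \<and> even u \<noteq> even w \<and> even v \<noteq> even w"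
    if w: "w < 8" "w \<notin> S" for w
  proof -
    have "w \<in> pverts ?B" using w by (simp add: bipartite_graph_def)
    then obtain u v where uv: "u \<in> S" "v \<in> S" "hops ?B u w + hops ?B w v = hops ?B u v"
      using geodetic_setD[OF S(1)] by metis
    have "u < 8" "v < 8" using uv sub by auto
    with uv w show ?thesis
      by (intro bexI[of _ u] bexI[of _ v]) (auto simp: hops_bipartite_graph split: if_splits)
  qed
  have side: "{w. w < 8 \<and> even w = b} \<subseteq> S \<or> 2 \<le> card {u \<in> S. even u \<noteq> b}" for b
  proof (rule disjCI)
    assume "\<not> 2 \<le> card {u \<in> S. even u \<noteq> b}"
    then have "u = v" if "u \<in> {u \<in> S. even u \<noteq> b}" "v \<in> {u \<in> S. even u \<noteq> b}" for u v
      using that fin card_le_Suc0_iff_eq[of "{u \<in> S. even u \<noteq> b}"] by auto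
    then show "{w. w < 8 \<and> even w = b} \<subseteq> S" using opposite by blast
  qed
  have "card {w::nat. w < 8 \<and> even w = b} = 4" for b
  proof -
    have "{w::nat. w < 8 \<and> even w = b} = set (filter (\<lambda>w. even w = b) [0..<8])" by auto
    also have "\<dots> = (if b then {0, 2, 4, 6} else {1, 3, 5, 7})"
      by (simp add: upt_rec) (simp add: eval_nat_numeral)
    finally show ?thesis by simp
  qed
  then have "4 \<le> card S" if "{w. w < 8 \<and> even w = b} \<subseteq> S" for b
    using card_mono[OF fin that] by simp
  moreover have "4 \<le> card S" if "2 \<le> card {u \<in> S. even u}" "2 \<le> card {u \<in> S. odd u}"
  proof -
    have "card S = card {u \<in> S. even u} + card {u \<in> S. odd u}"
      using fin by (subst card_Un_disjoint[symmetric]) (auto intro: arg_cong[where f = card])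
    with that show ?thesis by simp
  qed
  ultimately show ?thesis using side[of True] side[of False] S(2) by auto
qed

lemma geodetic_number_bipartite_complete:
  "min (geodetic_number (bipartite_graph 4)) (geodetic_number (complete_graph 4)) =
     geodetic_number (bipartite_graph 4 \<boxtimes> complete_graph 4)"
proof (rule antisym)
  let ?B = "bipartite_graph 4" and ?K = "complete_graph 4"
  interpret connected_pair_graph_pair ?B ?K
    by (simp add: connected_pair_graph_pair_def connected_bipartite_graph connected_complete_graph)
  show "min (geodetic_number ?B) (geodetic_number ?K) \<le> geodetic_number (?B \<boxtimes> ?K)"
    by (rule min_geodetic_number_le_strong_product)
  \<comment> \<open>Two vertices of each parity, all in the layer over vertex 0 of
    \<open>?K\<close>.\<close>
  let ?S = "{0, 1, 2, 3::nat} \<times> {0::nat}"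
  have "geodetic_set (?B \<boxtimes> ?K) ?S"
  proof (rule P.geodetic_setI)
    show "?S \<subseteq> pverts (?B \<boxtimes> ?K)" by (auto simp: bipartite_graph_def complete_graph_def)
    fix w assume "w \<in> pverts (?B \<boxtimes> ?K)"
    then obtain g h where w: "w = (g, h)" "g < 8" "h < 4"
      by (auto simp: bipartite_graph_def complete_graph_def)
    \<comment> \<open>\<open>x\<close> and \<open>x + 2\<close> lie on the side opposite to
      \<open>g\<close>, which is therefore their midpoint. Each half has length 1 in
      \<open>?B\<close> and at most 1 in \<open>?K\<close>, so moving to height \<open>h\<close> and
      back costs nothing extra.\<close>
    define x where "x = (if even g then 1 else 0 :: nat)"
    have V: "0 \<in> pverts ?K" "h \<in> pverts ?K" "x \<in> pverts ?B" "x + 2 \<in> pverts ?B" "g \<in> pverts ?B"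
      using w by (auto simp: bipartite_graph_def complete_graph_def x_def)
    have "hops ?K 0 h \<le> 1" "hops ?K h 0 \<le> 1" "hops ?K 0 0 = 0"
      using V H.hops_le_1_iff H.hops_eq_0_iff by (auto simp: complete_graph_def)
    moreover have "hops ?B x g = 1" "hops ?B g (x + 2) = 1" "hops ?B x (x + 2) = 2"
      using w by (auto simp: hops_bipartite_graph x_def intro: odd_pos)
    ultimately have "hops (?B \<boxtimes> ?K) (x, 0) w + hops (?B \<boxtimes> ?K) w (x + 2, 0) =
        hops (?B \<boxtimes> ?K) (x, 0) (x + 2, 0)"
      using V by (simp add: w(1) hops_strong_product)
    moreover have "(x, 0) \<in> ?S" "(x + 2, 0) \<in> ?S" by (auto simp: x_def)
    ultimately show "\<exists>u\<in>?S. \<exists>v\<in>?S.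
        hops (?B \<boxtimes> ?K) u w + hops (?B \<boxtimes> ?K) w v = hops (?B \<boxtimes> ?K) u v" by blast
  qed
  then have "geodetic_number (?B \<boxtimes> ?K) \<le> 4"
    using P.geodetic_number_le by (fastforce simp: card_cartesian_product)
  then show "geodetic_number (?B \<boxtimes> ?K) \<le> min (geodetic_number ?B) (geodetic_number ?K)"
    using geodetic_number_bipartite_graph_ge by (simp add: geodetic_number_complete_graph)
qed

text \<open>The product of complete graphs is again complete, so all of its \<open>m * n\<close>
  vertices are needed in a geodetic set.\<close>

lemma geodetic_number_complete_complete:
  "geodetic_number (complete_graph m \<boxtimes> complete_graph n) =
     geodetic_number (complete_graph m) * geodetic_number (complete_graph n)"
proof -
  interpret connected_pair_graph_pair "complete_graph m" "complete_graph n"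
    by (simp add: connected_pair_graph_pair_def connected_complete_graph)
  have "geodetic_number (complete_graph m \<boxtimes> complete_graph n) =
      card (pverts (complete_graph m \<boxtimes> complete_graph n))"
    by (rule P.geodetic_number_complete) (auto simp: strong_product_def complete_graph_def)
  then show ?thesis
    by (simp add: geodetic_number_complete_graph card_cartesian_product)
       (simp add: complete_graph_def)
qed

theorem theorem1:
  shows "(\<forall>(G :: 'a pair_pre_digraph) (H :: 'b pair_pre_digraph).
            nontrivial_connected_graph G \<and> nontrivial_connected_graph H \<longrightarrow>
              min (geodetic_number G) (geodetic_number H) \<le> geodetic_number (G \<boxtimes> H) \<and>
              geodetic_number (G \<boxtimes> H) \<le> geodetic_number G * geodetic_number H) \<and>
         (\<exists>(G :: nat pair_pre_digraph) (H :: nat pair_pre_digraph).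
            nontrivial_connected_graph G \<and> nontrivial_connected_graph H \<and>
            min (geodetic_number G) (geodetic_number H) = geodetic_number (G \<boxtimes> H)) \<and>
         (\<exists>(G :: nat pair_pre_digraph) (H :: nat pair_pre_digraph).
            nontrivial_connected_graph G \<and> nontrivial_connected_graph H \<and>
            geodetic_number (G \<boxtimes> H) = geodetic_number G * geodetic_number H)"
proof (intro conjI allI impI)
  fix G :: "'a pair_pre_digraph" and H :: "'b pair_pre_digraph"
  assume "nontrivial_connected_graph G \<and> nontrivial_connected_graph H"
  then interpret connected_pair_graph_pair G H
    by (simp add: connected_pair_graph_pair_def nontrivial_connected_graph_iff)
  show "min (geodetic_number G) (geodetic_number H) \<le> geodetic_number (G \<boxtimes> H)"
    by (rule min_geodetic_number_le_strong_product)
  show "geodetic_number (G \<boxtimes> H) \<le> geodetic_number G * geodetic_number H"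
    by (rule geodetic_number_strong_product_le)
next
  have complete: "nontrivial_connected_graph (complete_graph n)" if "2 \<le> n" for n
    using that by (simp add: nontrivial_connected_graph_iff connected_complete_graph)
      (simp add: complete_graph_def)
  have "nontrivial_connected_graph (bipartite_graph 4)"
    by (simp add: nontrivial_connected_graph_iff connected_bipartite_graph)
      (simp add: bipartite_graph_def)
  then show "\<exists>(G :: nat pair_pre_digraph) (H :: nat pair_pre_digraph).
      nontrivial_connected_graph G \<and> nontrivial_connected_graph H \<and>
      min (geodetic_number G) (geodetic_number H) = geodetic_number (G \<boxtimes> H)"
    using complete[of 4] geodetic_number_bipartite_complete by auto
  show "\<exists>(G :: nat pair_pre_digraph) (H :: nat pair_pre_digraph).
      nontrivial_connected_graph G \<and> nontrivial_connected_graph H \<and>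
      geodetic_number (G \<boxtimes> H) = geodetic_number G * geodetic_number H"
    using complete[of 2] geodetic_number_complete_complete[of 2 2] by auto
qed

end
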